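(* Let $p\in\mathbb{C}[Z]$ be a polynomial of degree $d\ge 3$ with only simple roots. Then there exist vectors $\underline z\in\mathbb{C}^d$ such that $W_p^{\circ n}(\underline z)$ is defined for all $n\ge 0$ and the orbit $(W_p^{\circ n}(\underline z))_{n\ge0}$ tends to infinity (eventually leaves every compact subset of $\mathbb{C}^d$). Moreover, the set of such escaping points contains a holomorphic curve.
   Context: For a monic polynomial $p\in\mathbb{C}[Z]$ of degree $d$, the Weierstrass map $W_p$ is the partially defined map $\mathbb{C}^d\setminus\Delta\to\mathbb{C}^d$, $\underline z\mapsto \underline z'$ with $z'_k=z_k-\dfrac{p(z_k)}{\prod_{j\ne k}(z_k-z_j)}$, where $\Delta=\{\underline z\in\mathbb{C}^d: z_j=z_k\text{ for some }j<k\}$. For non-monic $p$ with leading coefficient $c$, $W_p:=W_{p/c}$. *)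

theory Defs
  imports "HOL-Complex_Analysis.Complex_Analysis" "HOL-Computational_Algebra.Polynomial"
begin

definition cvecs :: "nat \<Rightarrow> (nat \<Rightarrow> complex) set" where
  "cvecs d = {z. \<forall>k\<ge>d. z k = 0}"

definition diag :: "nat \<Rightarrow> (nat \<Rightarrow> complex) set" where
  "diag d = {z. \<exists>j k. j < k \<and> k < d \<and> z j = z k}"

definition weierstrass :: "complex poly \<Rightarrow> (nat \<Rightarrow> complex) \<Rightarrow> (nat \<Rightarrow> complex) option" where
  "weierstrass p z =
     (let d = degree p; q = smult (inverse (lead_coeff p)) p in
      if z \<in> diag d then None
      else Some (\<lambda>k. if k < d then
                       z k - poly q (z k) / (\<Prod>j\<in>{..<d} - {k}. (z k - z j))
                     else 0))"

definition weierstrass_iter :: "complex poly \<Rightarrow> nat \<Rightarrow> (nat \<Rightarrow> complex) \<Rightarrow> (nat \<Rightarrow> complex) option" where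
  "weierstrass_iter p n z = ((\<lambda>x. Option.bind x (weierstrass p)) ^^ n) (Some z)"

definition vnorm :: "nat \<Rightarrow> (nat \<Rightarrow> complex) \<Rightarrow> real" where
  "vnorm d z = Max (insert 0 ((\<lambda>k. cmod (z k)) ` {..<d}))"

definition escaping :: "complex poly \<Rightarrow> (nat \<Rightarrow> complex) \<Rightarrow> bool" where
  "escaping p z \<longleftrightarrow> z \<in> cvecs (degree p) \<and>
     (\<forall>n. weierstrass_iter p n z \<noteq> None) \<and>
     filterlim (\<lambda>n. vnorm (degree p) (the (weierstrass_iter p n z))) at_top sequentially"

end

theory Submission
  imports Defs "HOL-Computational_Algebra.Fundamental_Theorem_Algebra"
begin

text \<open>
  Fixing all but three entries at roots of \<open>p\<close> reduces the problem to a cubic, which after a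
  translation reads \<open>Z^3 + a Z + b\<close>. A single step makes the three remaining entries sum to zero, so
  they live in a plane. On its line at infinity the step depends only on the leading term \<open>Z^3\<close>; up to
  exchanging two entries, the direction with entry ratio
  \<open>t = (z_0 - z_1) / z_2\<close>, where \<open>3 t^4 - 22 t^2 + 3 = 0\<close> and \<open>7 < t^2 < 9\<close>, is fixed. It is a saddle:
  in the radial coordinate \<open>1 / z_2\<close> the multiplier has modulus \<open>(9 - t^2) / (t^2 - 5) < 1\<close>, and along the
  line at infinity it has modulus \<open>(5 t^2 - 17) / (t^2 - 5) > 1\<close>. Its stable manifold is the
  holomorphic curve of escaping points.
\<close>

subsection \<open>Difference quotients of functions of two variables\<close>

text \<open>Strict differentiability at \<open>p\<close> with partial derivatives \<open>a\<close>
  and \<open>b\<close>, in Caratheodory form: both points of the difference quotient move. This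
  gives Lipschitz bounds for the nonlinear part, which mere differentiability at \<open>p\<close>
  would not.\<close>

definition has_slopes ::
  "(complex \<times> complex \<Rightarrow> complex) \<Rightarrow> complex \<times> complex \<Rightarrow> complex \<Rightarrow> complex \<Rightarrow> bool" where
  "has_slopes f p a b \<longleftrightarrow> (f \<longlongrightarrow> f p) (nhds p) \<and>
     (\<exists>A B. (A \<longlongrightarrow> a) (nhds (p, p)) \<and> (B \<longlongrightarrow> b) (nhds (p, p)) \<and>
       (\<forall>\<^sub>F z in nhds (p, p). f (fst z) - f (snd z) =
          A z * (fst (fst z) - fst (snd z)) + B z * (snd (fst z) - snd (snd z))))"

lemma has_slopes_const: "has_slopes (\<lambda>x. c) p 0 0"
  unfolding has_slopes_def by (auto intro!: exI[of _ "\<lambda>_. 0"])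

lemma has_slopes_fst: "has_slopes fst p 1 0"
  unfolding has_slopes_def
  by (intro conjI tendsto_fst filterlim_ident exI[of _ "\<lambda>_. 1"] exI[of _ "\<lambda>_. 0"]) auto

lemma has_slopes_snd: "has_slopes snd p 0 1"
  unfolding has_slopes_def
  by (intro conjI tendsto_snd filterlim_ident exI[of _ "\<lambda>_. 0"] exI[of _ "\<lambda>_. 1"]) auto

lemma tendsto_nhds_pair:
  assumes "(f \<longlongrightarrow> l) (nhds p)"
  shows "((\<lambda>z. f (fst z)) \<longlongrightarrow> l) (nhds (p, p))" and "((\<lambda>z. f (snd z)) \<longlongrightarrow> l) (nhds (p, p))"
  unfolding nhds_prod
  by (rule filterlim_compose[OF assms filterlim_fst], rule filterlim_compose[OF assms filterlim_snd])

lemma has_slopes_diff: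
  assumes "has_slopes f p a b" and "has_slopes g p c d"
  shows "has_slopes (\<lambda>x. f x - g x) p (a - c) (b - d)"
proof -
  from assms(1) obtain A B where f: "(f \<longlongrightarrow> f p) (nhds p)"
    and A: "(A \<longlongrightarrow> a) (nhds (p, p))" and B: "(B \<longlongrightarrow> b) (nhds (p, p))"
    and AB: "\<forall>\<^sub>F z in nhds (p, p). f (fst z) - f (snd z) =
          A z * (fst (fst z) - fst (snd z)) + B z * (snd (fst z) - snd (snd z))"
    unfolding has_slopes_def by blast
  from assms(2) obtain C D where g: "(g \<longlongrightarrow> g p) (nhds p)"
    and C: "(C \<longlongrightarrow> c) (nhds (p, p))" and D: "(D \<longlongrightarrow> d) (nhds (p, p))"
    and CD: "\<forall>\<^sub>F z in nhds (p, p). g (fst z) - g (snd z) =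
          C z * (fst (fst z) - fst (snd z)) + D z * (snd (fst z) - snd (snd z))"
    unfolding has_slopes_def by blast
  have "\<forall>\<^sub>F z in nhds (p, p). (f (fst z) - g (fst z)) - (f (snd z) - g (snd z)) =
      (A z - C z) * (fst (fst z) - fst (snd z)) + (B z - D z) * (snd (fst z) - snd (snd z))"
    using AB CD by eventually_elim (simp add: algebra_simps)
  with tendsto_diff[OF f g] tendsto_diff[OF A C] tendsto_diff[OF B D] show ?thesis
    unfolding has_slopes_def by blast
qed

lemma has_slopes_mult:
  assumes "has_slopes f p a b" and "has_slopes g p c d"
  shows "has_slopes (\<lambda>x. f x * g x) p (f p * c + a * g p) (f p * d + b * g p)"
proof -
  from assms(1) obtain A B where f: "(f \<longlongrightarrow> f p) (nhds p)"
    and A: "(A \<longlongrightarrow> a) (nhds (p, p))" and B: "(B \<longlongrightarrow> b) (nhds (p, p))"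
    and AB: "\<forall>\<^sub>F z in nhds (p, p). f (fst z) - f (snd z) =
          A z * (fst (fst z) - fst (snd z)) + B z * (snd (fst z) - snd (snd z))"
    unfolding has_slopes_def by blast
  from assms(2) obtain C D where g: "(g \<longlongrightarrow> g p) (nhds p)"
    and C: "(C \<longlongrightarrow> c) (nhds (p, p))" and D: "(D \<longlongrightarrow> d) (nhds (p, p))"
    and CD: "\<forall>\<^sub>F z in nhds (p, p). g (fst z) - g (snd z) =
          C z * (fst (fst z) - fst (snd z)) + D z * (snd (fst z) - snd (snd z))"
    unfolding has_slopes_def by blast
  note lims = tendsto_nhds_pair(1)[OF f] tendsto_nhds_pair(2)[OF g]
  have "\<forall>\<^sub>F z in nhds (p, p). f (fst z) * g (fst z) - f (snd z) * g (snd z) =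
      (f (fst z) * C z + A z * g (snd z)) * (fst (fst z) - fst (snd z)) +
      (f (fst z) * D z + B z * g (snd z)) * (snd (fst z) - snd (snd z))"
    using AB CD
  proof eventually_elim
    case (elim z)
    have "f (fst z) * g (fst z) - f (snd z) * g (snd z) =
        f (fst z) * (g (fst z) - g (snd z)) + (f (fst z) - f (snd z)) * g (snd z)"
      by (simp add: algebra_simps)
    then show ?case unfolding elim by (simp add: algebra_simps)
  qed
  moreover have "((\<lambda>z. f (fst z) * C z + A z * g (snd z)) \<longlongrightarrow> f p * c + a * g p) (nhds (p, p))"
    and "((\<lambda>z. f (fst z) * D z + B z * g (snd z)) \<longlongrightarrow> f p * d + b * g p) (nhds (p, p))"
    by (intro tendsto_intros lims A B C D)+
  ultimately show ?thesis
    unfolding has_slopes_def using tendsto_mult[OF f g] by blast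
qed

lemma has_slopes_inverse:
  assumes "has_slopes f p a b" and "f p \<noteq> 0"
  shows "has_slopes (\<lambda>x. inverse (f x)) p (- a / (f p * f p)) (- b / (f p * f p))"
proof -
  from assms(1) obtain A B where f: "(f \<longlongrightarrow> f p) (nhds p)"
    and A: "(A \<longlongrightarrow> a) (nhds (p, p))" and B: "(B \<longlongrightarrow> b) (nhds (p, p))"
    and AB: "\<forall>\<^sub>F z in nhds (p, p). f (fst z) - f (snd z) =
          A z * (fst (fst z) - fst (snd z)) + B z * (snd (fst z) - snd (snd z))"
    unfolding has_slopes_def by blast
  note lims = tendsto_nhds_pair[OF f]
  have "\<forall>\<^sub>F z in nhds (p, p). f (fst z) \<noteq> 0" and "\<forall>\<^sub>F z in nhds (p, p). f (snd z) \<noteq> 0"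
    by (rule tendsto_imp_eventually_ne[OF lims(1) assms(2)],
        rule tendsto_imp_eventually_ne[OF lims(2) assms(2)])
  with AB have "\<forall>\<^sub>F z in nhds (p, p). inverse (f (fst z)) - inverse (f (snd z)) =
      (- A z / (f (fst z) * f (snd z))) * (fst (fst z) - fst (snd z)) +
      (- B z / (f (fst z) * f (snd z))) * (snd (fst z) - snd (snd z))"
  proof eventually_elim
    case (elim z)
    then have "inverse (f (fst z)) - inverse (f (snd z)) =
        - (f (fst z) - f (snd z)) / (f (fst z) * f (snd z))"
      by (simp add: field_simps)
    then show ?case unfolding elim(1) by (simp add: add_divide_distrib diff_divide_distrib)
  qed
  moreover have "((\<lambda>z. - A z / (f (fst z) * f (snd z))) \<longlongrightarrow> - a / (f p * f p)) (nhds (p, p))"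
    and "((\<lambda>z. - B z / (f (fst z) * f (snd z))) \<longlongrightarrow> - b / (f p * f p)) (nhds (p, p))"
    using assms(2) by (intro tendsto_intros lims A B; simp)+
  ultimately show ?thesis
    unfolding has_slopes_def using tendsto_inverse[OF f assms(2)] by blast
qed

text \<open>Postpones the matching of slopes: the rules first compute whatever expressions they
  produce, and these are compared with the intended values at the end.\<close>

lemma has_slopes_eqI: "has_slopes f p a b \<Longrightarrow> a = a' \<Longrightarrow> b = b' \<Longrightarrow> has_slopes f p a' b'"
  by simp

lemmas has_slopes_intros =
  has_slopes_const has_slopes_fst has_slopes_snd has_slopes_diff has_slopes_mult has_slopes_inverse

lemma eventually_nhds_pair_box:
  fixes r0 t0 :: complex
  assumes "\<forall>\<^sub>F z in nhds ((r0, t0), (r0, t0)). P z"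
  obtains \<delta> where "\<delta> > 0"
    and "\<And>r t r' t'. \<lbrakk>cmod (r - r0) \<le> \<delta>; cmod (t - t0) \<le> \<delta>; cmod (r' - r0) \<le> \<delta>; cmod (t' - t0) \<le> \<delta>\<rbrakk>
      \<Longrightarrow> P ((r, t), (r', t'))"
proof -
  from assms obtain e where "e > 0" and e: "\<And>z. dist z ((r0, t0), (r0, t0)) < e \<Longrightarrow> P z"
    unfolding eventually_nhds_metric by blast
  show ?thesis
  \<comment> \<open>The product distance is at most the sum of four coordinate distances, and four
    times \<open>e / 5\<close> stays strictly below \<open>e\<close>.\<close>
  proof (rule that[of "e / 5"])
    fix r t r' t'
    assume *: "cmod (r - r0) \<le> e / 5" "cmod (t - t0) \<le> e / 5" "cmod (r' - r0) \<le> e / 5" "cmod (t' - t0) \<le> e / 5"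
    have "dist ((r, t), (r', t')) ((r0, t0), (r0, t0)) \<le> dist (r, t) (r0, t0) + dist (r', t') (r0, t0)"
      unfolding dist_Pair_Pair[of "(r, t)"] by (intro sqrt_sum_squares_le_sum) auto
    also have "\<dots> \<le> (dist r r0 + dist t t0) + (dist r' r0 + dist t' t0)"
      unfolding dist_Pair_Pair by (intro add_mono sqrt_sum_squares_le_sum) auto
    also have "\<dots> < e" using * \<open>e > 0\<close> by (simp add: dist_norm)
    finally show "P ((r, t), (r', t'))" by (rule e)
  qed (use \<open>e > 0\<close> in auto)
qed

text \<open>Subtracting the linear part leaves \<open>A z - a\<close> and \<open>B z - b\<close> as
  coefficients, and both are below \<open>\<epsilon>\<close> near the point.\<close>

lemma has_slopes_box:
  fixes r0 t0 :: complex
  assumes "has_slopes f (r0, t0) a b" and "\<epsilon> > 0"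
  obtains \<delta> where "\<delta> > 0"
    and "\<And>r t r' t'. \<lbrakk>cmod (r - r0) \<le> \<delta>; cmod (t - t0) \<le> \<delta>; cmod (r' - r0) \<le> \<delta>; cmod (t' - t0) \<le> \<delta>\<rbrakk>
      \<Longrightarrow> cmod (f (r, t) - f (r', t') - a * (r - r') - b * (t - t')) \<le> \<epsilon> * cmod (r - r') + \<epsilon> * cmod (t - t')"
proof -
  let ?F = "nhds ((r0, t0), (r0, t0))"
  from assms(1) obtain A B where A: "(A \<longlongrightarrow> a) ?F" and B: "(B \<longlongrightarrow> b) ?F"
    and AB: "\<forall>\<^sub>F z in ?F. f (fst z) - f (snd z) =
          A z * (fst (fst z) - fst (snd z)) + B z * (snd (fst z) - snd (snd z))"
    unfolding has_slopes_def by blast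
  have "\<forall>\<^sub>F z in ?F. cmod (f (fst z) - f (snd z) - a * (fst (fst z) - fst (snd z)) - b * (snd (fst z) - snd (snd z)))
      \<le> \<epsilon> * cmod (fst (fst z) - fst (snd z)) + \<epsilon> * cmod (snd (fst z) - snd (snd z))"
    using AB tendstoD[OF A assms(2)] tendstoD[OF B assms(2)]
  proof eventually_elim
    case (elim z)
    have "f (fst z) - f (snd z) - a * (fst (fst z) - fst (snd z)) - b * (snd (fst z) - snd (snd z)) =
       (A z - a) * (fst (fst z) - fst (snd z)) + (B z - b) * (snd (fst z) - snd (snd z))"
      unfolding elim(1) by (simp add: algebra_simps)
    also have "cmod \<dots> \<le> cmod (A z - a) * cmod (fst (fst z) - fst (snd z)) + cmod (B z - b) * cmod (snd (fst z) - snd (snd z))"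
      by (rule order_trans[OF norm_triangle_ineq]) (simp add: norm_mult)
    also have "\<dots> \<le> \<epsilon> * cmod (fst (fst z) - fst (snd z)) + \<epsilon> * cmod (snd (fst z) - snd (snd z))"
      using elim by (intro add_mono mult_right_mono) (auto simp: dist_norm)
    finally show ?case .
  qed
  from eventually_nhds_pair_box[OF this] that show ?thesis
    by (metis (no_types, lifting) fst_conv snd_conv)
qed

subsection \<open>The stable manifold of a saddle\<close>

text \<open>\<open>H\<close> moves the contracting coordinate \<open>r\<close>, \<open>G\<close> the
  expanding coordinate \<open>t\<close>; the axis \<open>r = 0\<close> is invariant and
  \<open>(0, t0)\<close> is fixed. Holomorphy is asked only for compositions with functions of one
  variable, so that no notion of holomorphy in two variables enters.\<close>

locale saddle =
  fixes G H :: "complex \<Rightarrow> complex \<Rightarrow> complex" and t0 \<mu> :: complex and \<delta> \<kappa> \<eta> :: real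
  assumes delta: "\<delta> > 0" and kappa: "0 \<le> \<kappa>" and eta: "0 \<le> \<eta>" and kappa_eta: "\<kappa> + \<eta> \<le> 1"
    and mu: "1 + 2 * \<eta> < cmod \<mu>"
    and G_fix: "G 0 t0 = t0" and H_zero: "\<And>t. H 0 t = 0"
    and H_lip: "\<And>r t r' t'. \<lbrakk>cmod r \<le> \<delta>; cmod (t - t0) \<le> \<delta>; cmod r' \<le> \<delta>; cmod (t' - t0) \<le> \<delta>\<rbrakk>
      \<Longrightarrow> cmod (H r t - H r' t') \<le> \<kappa> * cmod (r - r') + \<eta> * cmod (t - t')"
    and G_lip: "\<And>r t r' t'. \<lbrakk>cmod r \<le> \<delta>; cmod (t - t0) \<le> \<delta>; cmod r' \<le> \<delta>; cmod (t' - t0) \<le> \<delta>\<rbrakk>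
      \<Longrightarrow> cmod (G r t - G r' t' - \<mu> * (t - t')) \<le> \<eta> * cmod (r - r') + \<eta> * cmod (t - t')"
    and H_hol: "\<And>f g. \<lbrakk>f holomorphic_on ball 0 \<delta>; g holomorphic_on ball 0 \<delta>;
        \<And>w. w \<in> ball 0 \<delta> \<Longrightarrow> cmod (f w) \<le> \<delta> \<and> cmod (g w - t0) \<le> \<delta>\<rbrakk>
      \<Longrightarrow> (\<lambda>w. H (f w) (g w)) holomorphic_on ball 0 \<delta>"
    and G_hol: "\<And>f g. \<lbrakk>f holomorphic_on ball 0 \<delta>; g holomorphic_on ball 0 \<delta>;
        \<And>w. w \<in> ball 0 \<delta> \<Longrightarrow> cmod (f w) \<le> \<delta> \<and> cmod (g w - t0) \<le> \<delta>\<rbrakk>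
      \<Longrightarrow> (\<lambda>w. G (f w) (g w)) holomorphic_on ball 0 \<delta>"
begin

text \<open>The \<open>r\<close>-coordinates driven from \<open>w\<close> by a prescribed sequence
  \<open>x\<close> of \<open>t\<close>-coordinates, which need not itself come from an
  orbit.\<close>

primrec stable_coord :: "complex \<Rightarrow> (nat \<Rightarrow> complex) \<Rightarrow> nat \<Rightarrow> complex" where
  "stable_coord w x 0 = w"
| "stable_coord w x (Suc n) = H (stable_coord w x n) (x n)"

text \<open>The recursion \<^term>\<open>x (Suc n) = G (stable_coord w x n) (x n)\<close> expands, so it is solved for
  \<^term>\<open>x n\<close>, which makes it a contraction in the supremum norm.\<close>

definition backward_step :: "complex \<Rightarrow> (nat \<Rightarrow> complex) \<Rightarrow> nat \<Rightarrow> complex" where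
  "backward_step w x n = x n + (x (Suc n) - G (stable_coord w x n) (x n)) / \<mu>"

abbreviation near :: "(nat \<Rightarrow> complex) \<Rightarrow> bool" where
  "near x \<equiv> \<forall>n. cmod (x n - t0) \<le> \<delta>"

definition iterate :: "nat \<Rightarrow> complex \<Rightarrow> nat \<Rightarrow> complex" where
  "iterate k w = (backward_step w ^^ k) (\<lambda>_. t0)"

definition rate :: real where
  "rate = (1 + 2 * \<eta>) / cmod \<mu>"

section \<open>Estimates for the backward step\<close>

lemma mu_pos: "cmod \<mu> > 0"
  using mu eta by linarith

lemma rate: "0 \<le> rate" "rate < 1"
  unfolding rate_def using mu eta mu_pos by (auto simp: divide_simps)

lemma norm_H_le:
  assumes "cmod r \<le> \<delta>" and "cmod (t - t0) \<le> \<delta>"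
  shows "cmod (H r t) \<le> \<kappa> * cmod r"
  using H_lip[of r t 0 t] assms delta by (simp add: H_zero)

lemma norm_stable_coord_le:
  assumes "cmod w \<le> \<delta>" and "near x"
  shows "cmod (stable_coord w x n) \<le> \<kappa> ^ n * cmod w"
    and "cmod (stable_coord w x n) \<le> \<delta>"
proof -
  have *: "\<kappa> ^ n * cmod w \<le> \<delta>" for n
  proof -
    have "\<kappa> ^ n * cmod w \<le> 1 * cmod w"
      using kappa kappa_eta eta by (intro mult_right_mono power_le_one) auto
    with assms(1) show ?thesis by simp
  qed
  show le: "cmod (stable_coord w x n) \<le> \<kappa> ^ n * cmod w"
  proof (induction n)
    case (Suc n)
    have "cmod (stable_coord w x (Suc n)) \<le> \<kappa> * cmod (stable_coord w x n)"
      using norm_H_le[OF order_trans[OF Suc *]] assms(2) by simp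
    also have "\<dots> \<le> \<kappa> * (\<kappa> ^ n * cmod w)"
      using Suc kappa by (rule mult_left_mono)
    finally show ?case by simp
  qed simp
  show "cmod (stable_coord w x n) \<le> \<delta>"
    using le * by (rule order_trans)
qed

text \<open>Both sequences start at \<open>w\<close>, so the difference begins at 0, and
  \<open>\<kappa> + \<eta> \<le> 1\<close> keeps the bound \<open>C\<close> from growing along the
  orbit.\<close>

lemma stable_coord_lip:
  assumes "cmod w \<le> \<delta>" and "near x" and "near y" and "\<And>n. cmod (x n - y n) \<le> C"
  shows "cmod (stable_coord w x n - stable_coord w y n) \<le> C"
proof (induction n)
  case 0
  show ?case using order_trans[OF norm_ge_zero assms(4)] by simp
next
  case (Suc n)
  have "cmod (stable_coord w x (Suc n) - stable_coord w y (Suc n))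
      \<le> \<kappa> * cmod (stable_coord w x n - stable_coord w y n) + \<eta> * cmod (x n - y n)"
    using assms norm_stable_coord_le(2)[OF assms(1)] by (simp add: H_lip)
  also have "\<dots> \<le> \<kappa> * C + \<eta> * C"
    using Suc assms(4) kappa eta by (intro add_mono mult_left_mono)
  also have "\<dots> = (\<kappa> + \<eta>) * C" by (simp add: algebra_simps)
  also have "\<dots> \<le> C"
    using kappa_eta order_trans[OF norm_ge_zero assms(4)] by (simp add: mult_left_le_one_le kappa eta)
  finally show ?case .
qed

text \<open>The linear part \<open>\<mu> * (x n - y n)\<close> of \<open>G\<close> cancels against
  the summand \<open>x n\<close>. What remains is the shifted difference, at most \<open>C\<close>,
  and the error of \<open>G\<close>, at most \<open>2 * \<eta> * C\<close>, all divided by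
  \<open>\<mu>\<close>.\<close>

lemma backward_step_lip:
  assumes "cmod w \<le> \<delta>" and "near x" and "near y" and "\<And>n. cmod (x n - y n) \<le> C"
  shows "cmod (backward_step w x n - backward_step w y n) \<le> rate * C"
proof -
  let ?r = "stable_coord w x n" and ?r' = "stable_coord w y n"
  have "backward_step w x n - backward_step w y n =
      ((x (Suc n) - y (Suc n)) - (G ?r (x n) - G ?r' (y n) - \<mu> * (x n - y n))) / \<mu>"
    using mu_pos unfolding backward_step_def by (auto simp: field_simps)
  also have "cmod \<dots> \<le> (cmod (x (Suc n) - y (Suc n)) + cmod (G ?r (x n) - G ?r' (y n) - \<mu> * (x n - y n))) / cmod \<mu>"
    unfolding norm_divide by (intro divide_right_mono norm_triangle_ineq4) auto
  also have "\<dots> \<le> (C + (\<eta> * C + \<eta> * C)) / cmod \<mu>"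
  proof (intro divide_right_mono add_mono assms(4))
    have "cmod (G ?r (x n) - G ?r' (y n) - \<mu> * (x n - y n)) \<le> \<eta> * cmod (?r - ?r') + \<eta> * cmod (x n - y n)"
      using assms norm_stable_coord_le(2)[OF assms(1)] by (simp add: G_lip)
    also have "\<dots> \<le> \<eta> * C + \<eta> * C"
      using stable_coord_lip[OF assms] assms(4) eta by (intro add_mono mult_left_mono) auto
    finally show "cmod (G ?r (x n) - G ?r' (y n) - \<mu> * (x n - y n)) \<le> \<eta> * C + \<eta> * C" .
  qed simp
  also have "\<dots> = rate * C" unfolding rate_def by (simp add: algebra_simps)
  finally show ?thesis .
qed

text \<open>The same estimate as for two sequences, with the fixed point \<open>(0, t0)\<close> as
  the second orbit and \<open>\<delta>\<close> in place of \<open>C\<close>.\<close>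

lemma near_backward_step:
  assumes "cmod w \<le> \<delta>" and "near x"
  shows "near (backward_step w x)"
proof
  fix n
  let ?r = "stable_coord w x n"
  have "backward_step w x n - t0 =
      ((x (Suc n) - t0) - (G ?r (x n) - G 0 t0 - \<mu> * (x n - t0))) / \<mu>"
    using mu_pos unfolding backward_step_def G_fix by (auto simp: field_simps)
  also have "cmod \<dots> \<le> (cmod (x (Suc n) - t0) + cmod (G ?r (x n) - G 0 t0 - \<mu> * (x n - t0))) / cmod \<mu>"
    unfolding norm_divide by (intro divide_right_mono norm_triangle_ineq4) auto
  also have "\<dots> \<le> (\<delta> + (\<eta> * \<delta> + \<eta> * \<delta>)) / cmod \<mu>"
  proof (intro divide_right_mono add_mono)
    have "cmod (G ?r (x n) - G 0 t0 - \<mu> * (x n - t0)) \<le> \<eta> * cmod (?r - 0) + \<eta> * cmod (x n - t0)"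
      using assms norm_stable_coord_le(2)[OF assms] delta by (intro G_lip) auto
    also have "\<dots> \<le> \<eta> * \<delta> + \<eta> * \<delta>"
      using norm_stable_coord_le(2)[OF assms] assms(2) eta by (intro add_mono mult_left_mono) auto
    finally show "cmod (G ?r (x n) - G 0 t0 - \<mu> * (x n - t0)) \<le> \<eta> * \<delta> + \<eta> * \<delta>" .
  qed (use assms in auto)
  also have "\<dots> = rate * \<delta>" unfolding rate_def by (simp add: algebra_simps)
  also have "\<dots> \<le> \<delta>" using rate delta by (simp add: mult_left_le_one_le)
  finally show "cmod (backward_step w x n - t0) \<le> \<delta>" .
qed

section \<open>Convergence of the iterates to a genuine orbit\<close>

lemma iterate_simps: "iterate 0 w = (\<lambda>_. t0)" "iterate (Suc k) w = backward_step w (iterate k w)"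
  by (simp_all add: iterate_def)

lemma near_iterate:
  assumes "cmod w \<le> \<delta>"
  shows "near (iterate k w)"
proof (induction k)
  case 0
  then show ?case using delta by (simp add: iterate_simps)
next
  case (Suc k)
  then show ?case using near_backward_step[OF assms] by (simp add: iterate_simps)
qed

lemma iterate_diff_le:
  assumes "cmod w \<le> \<delta>"
  shows "cmod (iterate (Suc k) w n - iterate k w n) \<le> rate ^ k * \<delta>"
proof (induction k arbitrary: n)
  case 0
  then show ?case using near_iterate[OF assms, of 1] by (simp add: iterate_simps)
next
  case (Suc k)
  show ?case
    using backward_step_lip[OF assms near_iterate near_iterate, OF assms assms Suc]
    by (simp add: iterate_simps mult.assoc)
qed

text \<open>The limit of the iterates, written as a telescoping series to suit the Weierstrass
  M-test; \<open>t0\<close> is the zeroth iterate.\<close>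

definition stable_orbit :: "complex \<Rightarrow> nat \<Rightarrow> complex" where
  "stable_orbit w n = t0 + (\<Sum>k. iterate (Suc k) w n - iterate k w n)"

text \<open>A geometric series with ratio \<open>rate\<close> dominates the increments for all
  \<open>w\<close> and \<open>n\<close> at once. Uniformity in \<open>n\<close> lets the limit pass
  through \<open>backward_step\<close>, whose Lipschitz bound is in the supremum norm; uniformity in
  \<open>w\<close> preserves holomorphy.\<close>

lemma iterate_uniform_limit:
  "uniform_limit ({w. cmod w \<le> \<delta>} \<times> UNIV) (\<lambda>k (w, n). iterate k w n)
     (\<lambda>(w, n). stable_orbit w n) sequentially"
proof -
  let ?S = "{w. cmod w \<le> \<delta>} \<times> (UNIV :: nat set)"
  have "uniform_limit ?S (\<lambda>k x. \<Sum>i<k. (\<lambda>(w, n). iterate (Suc i) w n - iterate i w n) x)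
      (\<lambda>x. \<Sum>i. (\<lambda>(w, n). iterate (Suc i) w n - iterate i w n) x) sequentially"
    using iterate_diff_le rate
    by (intro Weierstrass_m_test[where M = "\<lambda>k. rate ^ k * \<delta>"] summable_mult2 summable_geometric) auto
  moreover have "(\<Sum>i<k. iterate (Suc i) w n - iterate i w n) = iterate k w n - t0" for k w n
    using sum_lessThan_telescope[of "\<lambda>i. iterate i w n" k] by (simp add: iterate_simps(1))
  ultimately have "uniform_limit ?S (\<lambda>k x. (\<lambda>(w, n). iterate k w n - t0) x)
      (\<lambda>x. \<Sum>i. (\<lambda>(w, n). iterate (Suc i) w n - iterate i w n) x) sequentially"
    by (simp add: case_prod_unfold)
  from uniform_limit_add[OF uniform_limit_const this, of "\<lambda>_. t0"] show ?thesis
    by (rule uniform_limit_cong'[THEN iffD1, rotated -1])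
       (auto simp: stable_orbit_def)
qed

lemma iterate_tendsto:
  assumes "cmod w \<le> \<delta>"
  shows "(\<lambda>k. iterate k w n) \<longlonglongrightarrow> stable_orbit w n"
  using tendsto_uniform_limitI[OF iterate_uniform_limit, of "(w, n)"] assms by simp

lemma near_stable_orbit:
  assumes "cmod w \<le> \<delta>"
  shows "near (stable_orbit w)"
proof
  fix n
  have "(\<lambda>k. cmod (iterate k w n - t0)) \<longlonglongrightarrow> cmod (stable_orbit w n - t0)"
    by (intro tendsto_intros iterate_tendsto assms)
  then show "cmod (stable_orbit w n - t0) \<le> \<delta>"
    by (rule LIMSEQ_le_const2) (use near_iterate[OF assms] in auto)
qed

lemma backward_step_stable_orbit:
  assumes "cmod w \<le> \<delta>"
  shows "backward_step w (stable_orbit w) n = stable_orbit w n"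
proof -
  have "(\<lambda>k. iterate (Suc k) w n) \<longlonglongrightarrow> backward_step w (stable_orbit w) n"
  proof (rule tendstoI)
    fix e :: real
    assume "e > 0"
    have "\<forall>\<^sub>F k in sequentially. \<forall>x\<in>{w. cmod w \<le> \<delta>} \<times> UNIV.
        dist ((\<lambda>(w, n). iterate k w n) x) ((\<lambda>(w, n). stable_orbit w n) x) < e"
      using uniform_limitD[OF iterate_uniform_limit \<open>e > 0\<close>] .
    then show "\<forall>\<^sub>F k in sequentially. dist (iterate (Suc k) w n) (backward_step w (stable_orbit w) n) < e"
    proof eventually_elim
      case (elim k)
      then have *: "cmod (iterate k w m - stable_orbit w m) \<le> e" for m
        using assms by (auto simp: dist_norm intro: less_imp_le)
      have "dist (iterate (Suc k) w n) (backward_step w (stable_orbit w) n) \<le> rate * e"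
        using backward_step_lip[OF assms near_iterate near_stable_orbit, OF assms assms *]
        by (simp add: iterate_simps dist_norm)
      also have "\<dots> < e" using rate \<open>e > 0\<close> by simp
      finally show ?case .
    qed
  qed
  from LIMSEQ_unique[OF this LIMSEQ_Suc[OF iterate_tendsto[OF assms]]] show ?thesis .
qed

text \<open>At a fixed point of the backward step the correction term vanishes, which is the forward
  recursion.\<close>

lemma stable_orbit_Suc:
  assumes "cmod w \<le> \<delta>"
  shows "stable_orbit w (Suc n) = G (stable_coord w (stable_orbit w) n) (stable_orbit w n)"
  using backward_step_stable_orbit[OF assms, of n] mu_pos by (auto simp: backward_step_def)

section \<open>Holomorphic dependence on the starting value\<close>

lemma holomorphic_iterate: "(\<lambda>w. iterate k w n) holomorphic_on ball 0 \<delta>"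
proof (induction k arbitrary: n)
  case 0
  then show ?case by (simp add: iterate_simps)
next
  case (Suc k)
  have near: "cmod (iterate k w n - t0) \<le> \<delta>" if "w \<in> ball 0 \<delta>" for w n
    using near_iterate[of w] that by simp
  have coord: "cmod (stable_coord w (iterate k w) n) \<le> \<delta>" if "w \<in> ball 0 \<delta>" for w n
    using that by (intro norm_stable_coord_le near_iterate) auto
  \<comment> \<open>Inner induction along time at fixed \<open>k\<close>: each coordinate is
    \<open>H\<close> of two functions already known to be holomorphic in \<open>w\<close>.\<close>
  have "(\<lambda>w. stable_coord w (iterate k w) n) holomorphic_on ball 0 \<delta>" for n
  proof (induction n)
    case 0
    then show ?case by simp
  next
    case (Suc n)
    then show ?case
      using H_hol[OF Suc.IH \<open>\<And>n. (\<lambda>w. iterate k w n) holomorphic_on ball 0 \<delta>\<close>[of n]] near coord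
      by simp
  qed
  then have "(\<lambda>w. G (stable_coord w (iterate k w) n) (iterate k w n)) holomorphic_on ball 0 \<delta>"
    using near coord by (intro G_hol Suc) auto
  then show ?case
    unfolding iterate_simps backward_step_def using mu_pos by (intro holomorphic_intros Suc) auto
qed

lemma holomorphic_stable_orbit: "(\<lambda>w. stable_orbit w n) holomorphic_on ball 0 \<delta>"
proof (rule holomorphic_uniform_sequence[OF open_ball holomorphic_iterate])
  fix x :: complex
  assume "x \<in> ball 0 \<delta>"
  then obtain d where d: "d > 0" "cball x d \<subseteq> ball 0 \<delta>"
    using open_contains_cball open_ball by blast
  have "uniform_limit (cball x d) (\<lambda>k w. iterate k w n) (\<lambda>w. stable_orbit w n) sequentially"
  proof (rule uniform_limitI)
    fix e :: real
    assume "e > 0"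
    from uniform_limitD[OF iterate_uniform_limit this]
    show "\<forall>\<^sub>F k in sequentially. \<forall>w\<in>cball x d. dist (iterate k w n) (stable_orbit w n) < e"
      by eventually_elim (use d(2) in \<open>fastforce simp: subset_iff\<close>)
  qed
  with d show "\<exists>d>0. cball x d \<subseteq> ball 0 \<delta> \<and>
      uniform_limit (cball x d) (\<lambda>k w. iterate k w n) (\<lambda>w. stable_orbit w n) sequentially"
    by blast
qed

end

subsection \<open>Reduction to the cubic case\<close>

text \<open>Squarefreeness makes the factorisation run over the root set without multiplicities, so
  this set has \<open>degree p\<close> elements and can be indexed.\<close>

lemma rsquarefree_enumerate_roots:
  fixes p :: "complex poly"
  assumes "rsquarefree p"
  obtains \<alpha> where "inj_on \<alpha> {..<degree p}"
    and "\<And>x. poly (smult (inverse (lead_coeff p)) p) x = (\<Prod>i<degree p. x - \<alpha> i)"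
proof -
  let ?R = "{z. poly p z = 0}"
  have "p \<noteq> 0" using assms by (simp add: rsquarefree_def)
  then have fin: "finite ?R" by (rule poly_roots_finite)
  have p: "smult (lead_coeff p) (\<Prod>z\<in>?R. [:-z, 1:]) = p"
    by (rule complex_poly_decompose_rsquarefree[OF assms])
  have "degree p = degree (\<Prod>z\<in>?R. [:-z, 1:])"
    by (subst p[symmetric]) (use \<open>p \<noteq> 0\<close> in simp)
  also have "\<dots> = card ?R"
    by (subst degree_prod_sum_eq) auto
  finally obtain \<alpha> where \<alpha>: "bij_betw \<alpha> {..<degree p} ?R"
    using ex_bij_betw_nat_finite[OF fin] by (metis lessThan_atLeast0)
  have "poly (smult (inverse (lead_coeff p)) p) x = (\<Prod>i<degree p. x - \<alpha> i)" for x
  proof -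
    have "poly p x = lead_coeff p * (\<Prod>z\<in>?R. x - z)"
      by (subst p[symmetric]) (simp add: poly_prod)
    also have "(\<Prod>z\<in>?R. x - z) = (\<Prod>i<degree p. x - \<alpha> i)"
      using prod.reindex_bij_betw[OF \<alpha>, of "\<lambda>z. x - z"] by simp
    finally show ?thesis using \<open>p \<noteq> 0\<close> by simp
  qed
  with \<alpha> show ?thesis using that by (auto simp: bij_betw_def)
qed

lemma depressed_cubic:
  fixes x0 x1 x2 :: complex
  obtains c a b where "\<And>x. (x - x0) * (x - x1) * (x - x2) = (x - c) ^ 3 + a * (x - c) + b"
proof -
  define c where "c = (x0 + x1 + x2) / 3"
  define y0 y1 where "y0 = x0 - c" and "y1 = x1 - c"
  have x: "x0 = y0 + c" "x1 = y1 + c" "x2 = c - y0 - y1"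
    by (simp_all add: y0_def y1_def c_def field_simps)
  show ?thesis
    \<comment> \<open>The third shifted root is \<open>- (y0 + y1)\<close>, so these are the second
      elementary symmetric function and minus the product of the shifted roots.\<close>
    by (rule that[of c "y0 * y1 - (y0 + y1) ^ 2" "y0 * y1 * (y0 + y1)"])
       (unfold x, algebra)
qed

lemma vnorm_ge: "k < d \<Longrightarrow> cmod (z k) \<le> vnorm d z"
  unfolding vnorm_def by (rule Max_ge) auto

text \<open>Relative to the centroid the entries are \<open>(D - s) / 2\<close>,
  \<open>(- D - s) / 2\<close> and \<open>s\<close>, and \<open>u\<close> is four times the product
  of the differences of \<open>s\<close> from the other two. Multiplying by \<open>4 * D * u\<close>
  leaves a polynomial identity for the first entry; negating \<open>D\<close> and \<open>D'\<close>
  covers the second.\<close>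

lemma cubic_step:
  fixes s D a b :: complex
  assumes nz: "D \<noteq> 0" "D - 3 * s \<noteq> 0" "D + 3 * s \<noteq> 0"
    and u: "u = - (D - 3 * s) * (D + 3 * s)"
    and s': "s' * u = s * u - 4 * (s ^ 3 + a * s + b)"
    and D': "D' * (2 * D * u) = - (D ^ 4 - 12 * s\<^sup>2 * D\<^sup>2 + 3 * s ^ 4 + 4 * a * (3 * s\<^sup>2 - D\<^sup>2) - 24 * b * s)"
  shows "(D - s) / 2 - (((D - s) / 2) ^ 3 + a * ((D - s) / 2) + b) / (D * ((D - 3 * s) / 2)) = (D' - s') / 2"
proof -
  define x where "x = (D - s) / 2"
  have D: "D = 2 * x + s" by (simp add: x_def field_simps)
  have "u \<noteq> 0" using nz u by simp
  have "N / (D * (e / 2)) * (4 * D * (- e * f)) = - (8 * N * f)" if "e \<noteq> 0" for N e f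
    using nz(1) that by (simp add: field_simps)
  from this[OF nz(2), of "x ^ 3 + a * x + b" "D + 3 * s"]
  have "(x ^ 3 + a * x + b) / (D * ((D - 3 * s) / 2)) * (4 * D * u) = - (8 * (x ^ 3 + a * x + b) * (D + 3 * s))"
    unfolding u .
  then have "(x - (x ^ 3 + a * x + b) / (D * ((D - 3 * s) / 2))) * (4 * D * u)
      = x * (4 * D * u) + 8 * (x ^ 3 + a * x + b) * (D + 3 * s)"
    by (simp add: left_diff_distrib)
  also have "\<dots> = D' * (2 * D * u) - 2 * D * (s' * u)"
    unfolding D' s' unfolding u D by algebra
  also have "\<dots> = ((D' - s') / 2) * (4 * D * u)"
    by (simp add: algebra_simps)
  finally have "(x - (x ^ 3 + a * x + b) / (D * ((D - 3 * s) / 2))) = (D' - s') / 2"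
    by (rule mult_right_cancel[THEN iffD1, rotated]) (use nz(1) \<open>u \<noteq> 0\<close> in simp)
  then show ?thesis unfolding x_def .
qed

locale cubic_times_roots =
  fixes p :: "complex poly" and \<alpha> :: "nat \<Rightarrow> complex" and c a b :: complex
  assumes degree: "degree p \<ge> 3"
    and inj: "inj_on \<alpha> {..<degree p}"
    and poly_eq: "\<And>x. poly (smult (inverse (lead_coeff p)) p) x
      = ((x - c) ^ 3 + a * (x - c) + b) * (\<Prod>i\<in>{3..<degree p}. x - \<alpha> i)"
begin

text \<open>All but three approximations sit at roots of \<^term>\<open>p\<close>, hence stay there, and
  the other three move as for the cubic cofactor. Their centroid is that of the roots of the cubic, which
  any step enforces.\<close>

definition state :: "complex \<Rightarrow> complex \<Rightarrow> nat \<Rightarrow> complex" where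
  "state s D k =
     (if k = 0 then c + (D - s) / 2
      else if k = 1 then c + (- D - s) / 2
      else if k = 2 then c + s
      else if k < degree p then \<alpha> k else 0)"

lemma lessThan_degree: "{..<degree p} = {0, 1, 2} \<union> {3..<degree p}"
  using degree by auto

lemma state_not_diag:
  assumes "D \<noteq> 0" and "D \<noteq> 3 * s" and "D \<noteq> - 3 * s"
    and "\<And>k i. k < 3 \<Longrightarrow> 3 \<le> i \<Longrightarrow> i < degree p \<Longrightarrow> state s D k \<noteq> \<alpha> i"
  shows "state s D \<notin> diag (degree p)"
proof
  assume "state s D \<in> diag (degree p)"
  then obtain j k where jk: "j < k" "k < degree p" "state s D j = state s D k"
    unfolding diag_def by blast
  consider "k < 3" | "j < 3" "k \<ge> 3" | "j \<ge> 3" by linarith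
  then show False
  proof cases
    case 1
    with jk(1) consider "j = 0" "k = 1" | "j = 0" "k = 2" | "j = 1" "k = 2" by linarith
    then show False
    proof cases
      case 1
      with jk(3) have "D = 0" by (simp add: state_def field_simps)
      with assms(1) show False by simp
    next
      case 2
      with jk(3) have "D = 3 * s" by (simp add: state_def field_simps)
      with assms(2) show False by simp
    next
      case 3
      with jk(3) have "(- D - s) / 2 = s" by (simp add: state_def)
      then have "- D - s = 2 * s" by (simp add: field_simps)
      then have "D = - 3 * s" by algebra
      with assms(3) show False by simp
    qed
  next
    case 2
    have "state s D k = \<alpha> k" using 2 jk(2) by (simp add: state_def)
    with assms(4)[OF 2 jk(2)] jk(3) show False by simp
  next
    case 3
    then have "\<alpha> j = \<alpha> k" using jk by (simp add: state_def)
    from inj_onD[OF inj this] jk(1,2) show False by simp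
  qed
qed

lemma prod_state:
  assumes "k < 3"
  shows "(\<Prod>j\<in>{..<degree p} - {k}. x - state s D j)
    = (\<Prod>j\<in>{0, 1, 2} - {k}. x - state s D j) * (\<Prod>i\<in>{3..<degree p}. x - \<alpha> i)"
proof -
  have *: "{..<degree p} - {k} = ({0, 1, 2} - {k}) \<union> {3..<degree p}"
    using assms unfolding lessThan_degree by auto
  have "(\<Prod>j\<in>{..<degree p} - {k}. x - state s D j)
      = (\<Prod>j\<in>{0, 1, 2} - {k}. x - state s D j) * (\<Prod>i\<in>{3..<degree p}. x - state s D i)"
    unfolding * by (rule prod.union_disjoint) auto
  then show ?thesis by (simp add: state_def)
qed

lemma weierstrass_state:
  assumes D: "D \<noteq> 0" "D \<noteq> 3 * s" "D \<noteq> - 3 * s"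
    and avoid: "\<And>k i. k < 3 \<Longrightarrow> 3 \<le> i \<Longrightarrow> i < degree p \<Longrightarrow> state s D k \<noteq> \<alpha> i"
    and s': "s' = s - 4 * (s ^ 3 + a * s + b) / (9 * s\<^sup>2 - D\<^sup>2)"
    and D': "D' * (2 * D * (9 * s\<^sup>2 - D\<^sup>2)) = - (D ^ 4 - 12 * s\<^sup>2 * D\<^sup>2 + 3 * s ^ 4 + 4 * a * (3 * s\<^sup>2 - D\<^sup>2) - 24 * b * s)"
  shows "weierstrass p (state s D) = Some (state s' D')"
proof -
  let ?z = "state s D" and ?q = "smult (inverse (lead_coeff p)) p"
  let ?P = "\<lambda>x. x ^ 3 + a * x + b"
  have nz: "D \<noteq> 0" "D - 3 * s \<noteq> 0" "D + 3 * s \<noteq> 0" using D by (auto simp: eq_neg_iff_add_eq_0)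
  define u where "u = 9 * s\<^sup>2 - D\<^sup>2"
  have u: "u = - (D - 3 * s) * (D + 3 * s)" unfolding u_def by algebra
  then have "u \<noteq> 0" using nz by simp
  have s'u: "s' * u = s * u - 4 * ?P s" using \<open>u \<noteq> 0\<close> unfolding s' u_def[symmetric] by (simp add: field_simps)
  have D'u: "D' * (2 * D * u) = - (D ^ 4 - 12 * s\<^sup>2 * D\<^sup>2 + 3 * s ^ 4 + 4 * a * (3 * s\<^sup>2 - D\<^sup>2) - 24 * b * s)"
    using D' by (simp add: u_def)
  have z: "?z 0 - c = (D - s) / 2" "?z 1 - c = (- D - s) / 2" "?z 2 - c = s"
    and z': "state s' D' 0 = c + (D' - s') / 2" "state s' D' 1 = c + (- D' - s') / 2"
    by (simp_all add: state_def)
  \<comment> \<open>The factors from the entries sitting at roots occur in both the polynomial and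
    the denominator and cancel, leaving the correction of the cubic.\<close>
  have corr: "poly ?q (?z k) / (\<Prod>j\<in>{..<degree p} - {k}. (?z k - ?z j))
      = ?P (?z k - c) / (\<Prod>j\<in>{0, 1, 2} - {k}. ?z k - ?z j)" if "k < 3" for k
  proof -
    have "(\<Prod>i\<in>{3..<degree p}. ?z k - \<alpha> i) \<noteq> 0"
      using avoid[OF that] by auto
    then show ?thesis unfolding poly_eq prod_state[OF that] by simp
  qed
  have "?z k - poly ?q (?z k) / (\<Prod>j\<in>{..<degree p} - {k}. (?z k - ?z j)) = state s' D' k" if "k < degree p" for k
  proof -
    consider "k = 0" | "k = 1" | "k = 2" | "k \<ge> 3" by linarith
    then show ?thesis
    proof cases
      case 1
      have "{0, 1, 2} - {0} = {1, 2::nat}" by auto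
      then have prod: "(\<Prod>j\<in>{0, 1, 2} - {0}. ?z 0 - ?z j) = D * ((D - 3 * s) / 2)"
        by (simp add: state_def field_simps)
      have "poly ?q (?z 0) / (\<Prod>j\<in>{..<degree p} - {0}. (?z 0 - ?z j)) = ?P ((D - s) / 2) / (D * ((D - 3 * s) / 2))"
        using corr[of 0, unfolded z prod] by simp
      moreover have "?z 0 = c + (D - s) / 2" by (simp add: state_def)
      ultimately show ?thesis
        using cubic_step[OF nz u s'u D'u] unfolding 1 z' by (metis add_diff_eq)
    next
      case 2
      have "{0, 1, 2} - {1} = {0, 2::nat}" by auto
      then have prod: "(\<Prod>j\<in>{0, 1, 2} - {1}. ?z 1 - ?z j) = - D * ((- D - 3 * s) / 2)"
        by (simp add: state_def field_simps)
      have "poly ?q (?z 1) / (\<Prod>j\<in>{..<degree p} - {1}. (?z 1 - ?z j)) = ?P ((- D - s) / 2) / (- D * ((- D - 3 * s) / 2))"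
        using corr[of 1, unfolded z prod] by simp
      moreover have "(- D - s) / 2 - ?P ((- D - s) / 2) / (- D * ((- D - 3 * s) / 2)) = (- D' - s') / 2"
      proof (rule cubic_step)
        have "- D - 3 * s = - (D + 3 * s)" "- D + 3 * s = - (D - 3 * s)" by simp_all
        then show "- D \<noteq> 0" "- D - 3 * s \<noteq> 0" "- D + 3 * s \<noteq> 0"
          using nz by (simp_all only: neg_equal_0_iff_equal not_False_eq_True)
        show "u = - (- D - 3 * s) * (- D + 3 * s)" unfolding u by algebra
        show "s' * u = s * u - 4 * ?P s" by (rule s'u)
        show "- D' * (2 * - D * u) = - ((- D) ^ 4 - 12 * s\<^sup>2 * (- D)\<^sup>2 + 3 * s ^ 4 + 4 * a * (3 * s\<^sup>2 - (- D)\<^sup>2) - 24 * b * s)"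
          using D'u by simp
      qed
      moreover have "?z 1 = c + (- D - s) / 2" by (simp add: state_def)
      ultimately show ?thesis unfolding 2 z' by (metis add_diff_eq)
    next
      case 3
      have "{0, 1, 2} - {2} = {0, 1::nat}" by auto
      then have prod: "(\<Prod>j\<in>{0, 1, 2} - {2}. ?z 2 - ?z j) = u / 4"
        unfolding u by (simp add: state_def field_simps power2_eq_square)
      have "poly ?q (?z 2) / (\<Prod>j\<in>{..<degree p} - {2}. (?z 2 - ?z j)) = ?P s / (u / 4)"
        using corr[of 2, unfolded z prod] by simp
      then show ?thesis unfolding 3 by (simp add: state_def s' u_def)
    next
      case 4
      then have "poly ?q (?z k) = 0"
        using that unfolding poly_eq by (auto simp: state_def intro!: prod_zero)
      then show ?thesis using 4 that by (simp add: state_def)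
    qed
  qed
  moreover have "state s' D' k = 0" if "\<not> k < degree p" for k
    using that degree by (auto simp: state_def)
  ultimately show ?thesis
    using state_not_diag[OF D avoid] unfolding weierstrass_def Let_def by (auto simp: fun_eq_iff)
qed

subsection \<open>Dynamics near the line at infinity\<close>

text \<open>In the coordinates \<^term>\<open>r = 1 / s\<close> and \<^term>\<open>t = D / s\<close>, the line at infinity is \<^term>\<open>r = 0\<close>. The
  step sends \<^term>\<open>(r, t)\<close> to \<^term>\<open>(next_r r t, - next_t r t)\<close>; the sign amounts to
  exchanging the first two entries. Sums are written as differences in \<open>next_t\<close> so that
  \<open>has_slopes_diff\<close> covers them.\<close>

definition den :: "complex \<Rightarrow> complex \<Rightarrow> complex" where
  "den r t = 5 - t * t - 4 * a * (r * r) - 4 * b * (r * r * r)"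

definition next_r :: "complex \<Rightarrow> complex \<Rightarrow> complex" where
  "next_r r t = r * (9 - t * t) * inverse (den r t)"

definition next_t :: "complex \<Rightarrow> complex \<Rightarrow> complex" where
  "next_t r t = (t * t * (t * t) - 12 * (t * t) - (- 3) - (- 4) * a * (r * r) * (3 - t * t) - 24 * b * (r * r * r))
     * inverse (2 * t * den r t)"

text \<open>The relation determining \<open>D'\<close> is unchanged when \<open>D\<close> and
  \<open>D'\<close> both change sign, so \<open>\<sigma>\<close> factors out and merely flips at
  each step.\<close>

lemma weierstrass_projective:
  assumes nz: "r \<noteq> 0" "t \<noteq> 0" "den r t \<noteq> 0" "t \<noteq> 3" "t \<noteq> - 3" and \<sigma>: "\<sigma> = 1 \<or> \<sigma> = -1"
    and avoid: "\<And>k i. k < 3 \<Longrightarrow> 3 \<le> i \<Longrightarrow> i < degree p \<Longrightarrow> state (1 / r) (\<sigma> * t / r) k \<noteq> \<alpha> i"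
  shows "weierstrass p (state (1 / r) (\<sigma> * t / r)) =
    Some (state (1 / next_r r t) (- \<sigma> * next_t r t / next_r r t))"
proof (rule weierstrass_state[OF _ _ _ avoid])
  define s where "s = 1 / r"
  have s: "1 / r = s" "\<sigma> * t / r = \<sigma> * t * s" "s * r = 1"
    using nz(1) by (simp_all add: s_def)
  have "s \<noteq> 0" using nz(1) by (simp add: s_def)
  have "9 - t * t = - (t - 3) * (t + 3)" by algebra
  then have nine: "9 - t * t \<noteq> 0"
    using nz(4,5) by (auto simp: eq_neg_iff_add_eq_0)
  have \<sigma>2: "\<sigma> * \<sigma> = 1" using \<sigma> by auto
  show "\<sigma> * t / r \<noteq> 0" using nz \<sigma> by auto
  have "\<sigma> * t \<noteq> 3" "\<sigma> * t \<noteq> - 3"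
    using nz(4,5) \<sigma> by (auto simp: minus_equation_iff[of t])
  then show "\<sigma> * t / r \<noteq> 3 * (1 / r)" "\<sigma> * t / r \<noteq> - 3 * (1 / r)"
    using nz(1) by (auto simp: field_simps)
  have u: "9 * (1 / r)\<^sup>2 - (\<sigma> * t / r)\<^sup>2 = (9 - t * t) / (r * r)"
    using \<sigma>2 nz(1) by (simp add: power2_eq_square field_simps)
  have "4 * ((1 / r) ^ 3 + a * (1 / r) + b) = 4 * (1 + a * (r * r) + b * (r * r * r)) / (r * r * r)"
    using nz(1) by (simp add: power3_eq_cube field_simps)
  then have corr: "4 * ((1 / r) ^ 3 + a * (1 / r) + b) / ((9 - t * t) / (r * r))
      = 4 * (1 + a * (r * r) + b * (r * r * r)) / (r * (9 - t * t))"
    using nz(1) by simp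
  have "den r t = (9 - t * t) - 4 * (1 + a * (r * r) + b * (r * r * r))"
    unfolding den_def by (simp add: algebra_simps)
  moreover have "(y - K) / (r * y) = 1 / r - K / (r * y)" if "y \<noteq> 0" for y K
    using that nz(1) by (simp add: diff_divide_distrib)
  ultimately have "den r t / (r * (9 - t * t)) = 1 / r - 4 * (1 + a * (r * r) + b * (r * r * r)) / (r * (9 - t * t))"
    using nine by metis
  moreover have "1 / next_r r t = den r t / (r * (9 - t * t))"
    using nz nine unfolding next_r_def by (simp add: field_simps)
  ultimately show "1 / next_r r t = 1 / r - 4 * ((1 / r) ^ 3 + a * (1 / r) + b) / (9 * (1 / r)\<^sup>2 - (\<sigma> * t / r)\<^sup>2)"
    unfolding u corr by simp
  define N where "N = t * t * (t * t) - 12 * (t * t) - (- 3) - (- 4) * a * (r * r) * (3 - t * t) - 24 * b * (r * r * r)"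
  have "next_t r t / next_r r t = N / (2 * t * r * (9 - t * t))"
    using nz nine unfolding next_t_def next_r_def N_def[symmetric] by (simp add: field_simps)
  then have ratio: "- \<sigma> * next_t r t / next_r r t = - \<sigma> * (N / (2 * t * r * (9 - t * t)))"
    by (metis times_divide_eq_right)
  have "- \<sigma> * x * (2 * (\<sigma> * t / r) * y) = - (\<sigma> * \<sigma>) * (x * (2 * (t / r) * y))" for x y
    by (simp add: mult_ac)
  then have "- \<sigma> * next_t r t / next_r r t * (2 * (\<sigma> * t / r) * ((9 - t * t) / (r * r))) =
      - (\<sigma> * \<sigma>) * (N / (2 * t * r * (9 - t * t)) * (2 * (t / r) * ((9 - t * t) / (r * r))))"
    unfolding ratio .
  also have "\<dots> = - (N * s ^ 4)"
    using nz nine \<sigma>2 unfolding s_def by (simp add: divide_simps power4_eq_xxxx)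
  \<comment> \<open>Homogenisation: since \<open>s * r = 1\<close>, each power of \<open>r\<close>
    in \<open>N\<close> lowers the power of \<open>s\<close>.\<close>
  also have "N * s ^ 4 = (t * s) ^ 4 - 12 * s\<^sup>2 * (t * s)\<^sup>2 + 3 * s ^ 4 + 4 * a * (3 * s\<^sup>2 - (t * s)\<^sup>2) - 24 * b * s"
    unfolding N_def using s(3) by algebra
  also have "t * s = t / r" by (simp add: s_def)
  finally show "- \<sigma> * next_t r t / next_r r t * (2 * (\<sigma> * t / r) * (9 * (1 / r)\<^sup>2 - (\<sigma> * t / r)\<^sup>2)) =
      - ((\<sigma> * t / r) ^ 4 - 12 * (1 / r)\<^sup>2 * (\<sigma> * t / r)\<^sup>2 + 3 * (1 / r) ^ 4
         + 4 * a * (3 * (1 / r)\<^sup>2 - (\<sigma> * t / r)\<^sup>2) - 24 * b * (1 / r))"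
    unfolding u using \<sigma> by (auto simp: s_def)
qed

section \<open>Linearisation at the fixed direction\<close>

lemma has_slopes_den: "has_slopes (\<lambda>x. den (fst x) (snd x)) (0, t) 0 (- 2 * t)"
  unfolding den_def by (rule has_slopes_eqI, (rule has_slopes_intros)+) auto

lemma den_0: "den 0 t = 5 - t * t"
  by (simp add: den_def)

text \<open>Because of the explicit factor \<open>r\<close>, at \<open>r = 0\<close> the slope along
  \<open>t\<close> vanishes and the slope along \<open>r\<close> is the value of the cofactor, the
  radial multiplier.\<close>

lemma has_slopes_next_r:
  assumes "5 - t * t \<noteq> 0"
  shows "has_slopes (\<lambda>x. next_r (fst x) (snd x)) (0, t) ((9 - t * t) / (5 - t * t)) 0"
  unfolding next_r_def
  by (rule has_slopes_eqI, (rule has_slopes_intros has_slopes_den)+)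
     (use assms in \<open>auto simp: den_0 divide_inverse\<close>)

text \<open>The assumption \<open>fixed\<close> is \<open>next_t 0 t = t\<close> with denominators
  cleared. Numerator and denominator depend on \<open>r\<close> only through its square and cube,
  hence the zero slope; the other slope is the quotient rule simplified by
  \<open>fixed\<close>.\<close>

lemma has_slopes_next_t:
  assumes "t \<noteq> 0" and "5 - t * t \<noteq> 0" and fixed: "3 * (t * t) * (t * t) - 22 * (t * t) + 3 = 0"
  shows "has_slopes (\<lambda>x. next_t (fst x) (snd x)) (0, t) 0 ((5 * (t * t) - 17) / (5 - t * t))"
    and "next_t 0 t = t"
proof -
  define e where "e = 5 - t * t"
  have "e \<noteq> 0" using assms(2) by (simp add: e_def)
  have num: "t * t * (t * t) - 12 * (t * t) + 3 = 2 * (t * t) * e"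
    unfolding e_def using fixed by algebra
  show "next_t 0 t = t"
    unfolding next_t_def den_0 e_def[symmetric] using num assms(1) \<open>e \<noteq> 0\<close> by (simp add: field_simps)
  have slope: "2 * (t * t) * e * (6 * (t * t) - 10) / (4 * (t * (e * (t * e))))
      + (4 * (t * (t * t)) - 24 * t) * (inverse t * inverse e) / 2 = (5 * (t * t) - 17) / e"
    using assms(1) \<open>e \<noteq> 0\<close> by (simp add: field_simps)
  show "has_slopes (\<lambda>x. next_t (fst x) (snd x)) (0, t) 0 ((5 * (t * t) - 17) / (5 - t * t))"
    unfolding next_t_def
    by (rule has_slopes_eqI, (rule has_slopes_intros has_slopes_den)+)
       (use assms slope num in \<open>auto simp: den_0 e_def\<close>)
qed

text \<open>Measured from \<open>c\<close>, a moving entry is \<open>x / (2 * r)\<close> with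
  \<open>x\<close> one of \<open>\<sigma> * t - 1\<close>, \<open>- \<sigma> * t - 1\<close> and
  \<open>2\<close>, each of modulus at least 1. It is thus farther than \<open>M\<close> from
  \<open>c\<close>, unlike the remaining roots.\<close>

lemma state_avoids_roots:
  assumes M: "\<And>i. 3 \<le> i \<Longrightarrow> i < degree p \<Longrightarrow> cmod (\<alpha> i - c) \<le> M"
    and r: "r \<noteq> 0" "2 * M * cmod r < 1"
    and t: "cmod (t - 1) \<ge> 1" "cmod (t + 1) \<ge> 1" and \<sigma>: "\<sigma> = 1 \<or> \<sigma> = -1"
    and k: "k < 3" "3 \<le> i" "i < degree p"
  shows "state (1 / r) (\<sigma> * t / r) k \<noteq> \<alpha> i"
proof
  assume eq: "state (1 / r) (\<sigma> * t / r) k = \<alpha> i"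
  have "\<exists>x. state (1 / r) (\<sigma> * t / r) k - c = x / (2 * r) \<and> cmod x \<ge> 1"
  proof -
    consider "k = 0" | "k = 1" | "k = 2" using k(1) by linarith
    then show ?thesis
    proof cases
      case 1
      then show ?thesis
        using \<sigma> t r(1) by (intro exI[of _ "\<sigma> * t - 1"])
          (auto simp: state_def field_simps norm_minus_commute norm_minus_cancel[of "t + 1", symmetric] simp del: norm_minus_cancel)
    next
      case 2
      then show ?thesis
        using \<sigma> t r(1) by (intro exI[of _ "- \<sigma> * t - 1"])
          (auto simp: state_def field_simps norm_minus_commute norm_minus_cancel[of "t + 1", symmetric] simp del: norm_minus_cancel)
    next
      case 3
      then show ?thesis
        using r(1) by (intro exI[of _ 2]) (auto simp: state_def field_simps)
    qed
  qed
  then obtain x where x: "\<alpha> i - c = x / (2 * r)" "cmod x \<ge> 1" using eq by auto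
  have "cmod x / (2 * cmod r) \<le> M" using M[OF k(2,3)] unfolding x(1) by (simp add: norm_divide norm_mult)
  then have "cmod x \<le> 2 * M * cmod r" using r(1) by (simp add: field_simps)
  with x(2) r(2) show False by linarith
qed

text \<open>The curve is the stable manifold of the fixed direction, parametrised by the initial
  radial coordinate \<open>w\<close>; the point \<open>w = 0\<close> lies at infinity and is
  removed.\<close>

lemma escaping_curve:
  obtains \<delta> T where "\<delta> > 0" and "T holomorphic_on ball 0 \<delta>"
    and "\<And>w. w \<in> ball 0 \<delta> - {0} \<Longrightarrow> escaping p (state (1 / w) (T w / w))"
proof -
  \<comment> \<open>The larger root of \<open>3 * (q * q) - 22 * q + 3\<close>, the fixed-point
    equation for \<open>q = t0 * t0\<close>.\<close>
  define q :: real where "q = (11 + 4 * sqrt 7) / 3"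
  have "26 / 10 \<le> sqrt 7" "sqrt 7 \<le> 265 / 100"
    by (rule real_le_rsqrt, simp add: power2_eq_square) (rule real_le_lsqrt, simp_all add: power2_eq_square)
  then have q: "7 < q" "q < 73 / 10" by (auto simp: q_def)
  have fixed: "3 * (q * q) - 22 * q + 3 = 0"
    unfolding q_def by (simp add: field_simps)
  define t0 where "t0 = complex_of_real (sqrt q)"
  have t0: "t0 * t0 = of_real q" using q by (simp add: t0_def flip: of_real_mult)
  have "(26 / 10)\<^sup>2 \<le> q" "q \<le> (28 / 10)\<^sup>2"
    using q by (simp_all add: power2_eq_square)
  from real_le_rsqrt[OF this(1)] real_le_lsqrt[OF _ this(2)]
  have sq: "26 / 10 \<le> sqrt q" "sqrt q \<le> 28 / 10"
    by simp_all
  have "t0 \<noteq> 0" using sq by (auto simp: t0_def)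
  have den0: "5 - t0 * t0 \<noteq> 0"
  proof -
    have "5 - t0 * t0 = of_real (5 - q)" unfolding t0 by simp
    then show ?thesis using q by (simp only: of_real_eq_0_iff)
  qed
  define \<mu> where "\<mu> = (5 * (t0 * t0) - 17) / (5 - t0 * t0)"
  \<comment> \<open>The modulus of the radial multiplier; it is below 1 because
    \<open>q > 7\<close>.\<close>
  define \<kappa>0 where "\<kappa>0 = (9 - q) / (q - 5)"
  have \<kappa>0: "0 \<le> \<kappa>0" "\<kappa>0 < 1" using q by (auto simp: \<kappa>0_def field_simps)
  have rad: "(9 - t0 * t0) / (5 - t0 * t0) = - of_real \<kappa>0"
    unfolding t0 \<kappa>0_def using q by (simp add: minus_divide_right)
  have "\<mu> = of_real ((5 * q - 17) / (5 - q))" unfolding \<mu>_def t0 by simp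
  then have "cmod \<mu> = \<bar>(5 * q - 17) / (5 - q)\<bar>" by (simp only: norm_of_real)
  also have "\<dots> = (5 * q - 17) / (q - 5)" using q by (simp add: abs_divide)
  also have "\<dots> > 1" using q by (simp add: field_simps)
  finally have \<mu>: "cmod \<mu> > 1" .
  \<comment> \<open>Small enough that \<open>\<kappa>0 + \<eta>\<close> is a contraction constant
    with another \<open>\<eta>\<close> to spare, and that \<open>\<mu>\<close> still expands after a
    loss of \<open>2 * \<eta>\<close>.\<close>
  define \<eta> where "\<eta> = min ((1 - \<kappa>0) / 2) ((cmod \<mu> - 1) / 4)"
  have \<eta>: "\<eta> > 0" "\<kappa>0 + \<eta> + \<eta> \<le> 1" "1 + 2 * \<eta> < cmod \<mu>"
    using \<kappa>0 \<mu> by (auto simp: \<eta>_def min_def field_simps)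
  have cubic: "3 * (t0 * t0) * (t0 * t0) - 22 * (t0 * t0) + 3 = 0"
  proof -
    have "3 * (t0 * t0) * (t0 * t0) - 22 * (t0 * t0) + 3 = of_real (3 * (q * q) - 22 * q + 3)"
      unfolding t0 by simp
    then show ?thesis unfolding fixed by simp
  qed
  obtain \<delta>1 where "\<delta>1 > 0" and \<delta>1: "\<And>r t r' t'. \<lbrakk>cmod (r - 0) \<le> \<delta>1; cmod (t - t0) \<le> \<delta>1; cmod (r' - 0) \<le> \<delta>1; cmod (t' - t0) \<le> \<delta>1\<rbrakk>
      \<Longrightarrow> cmod (next_r r t - next_r r' t' - - of_real \<kappa>0 * (r - r') - 0 * (t - t')) \<le> \<eta> * cmod (r - r') + \<eta> * cmod (t - t')"
    using has_slopes_box[OF has_slopes_next_r[OF den0, unfolded rad] \<eta>(1)] unfolding fst_conv snd_conv by metis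
  note slopes_t = has_slopes_next_t[OF \<open>t0 \<noteq> 0\<close> den0 cubic]
  obtain \<delta>2 where "\<delta>2 > 0" and \<delta>2: "\<And>r t r' t'. \<lbrakk>cmod (r - 0) \<le> \<delta>2; cmod (t - t0) \<le> \<delta>2; cmod (r' - 0) \<le> \<delta>2; cmod (t' - t0) \<le> \<delta>2\<rbrakk>
      \<Longrightarrow> cmod (next_t r t - next_t r' t' - 0 * (r - r') - \<mu> * (t - t')) \<le> \<eta> * cmod (r - r') + \<eta> * cmod (t - t')"
    using has_slopes_box[OF slopes_t(1)[folded \<mu>_def] \<eta>(1)] unfolding fst_conv snd_conv by metis
  have "((\<lambda>x. den (fst x) (snd x)) \<longlongrightarrow> den 0 t0) (nhds (0, t0))"
    using has_slopes_den[of t0] unfolding has_slopes_def by simp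
  from tendsto_nhds_pair(1)[OF this]
  have "\<forall>\<^sub>F z in nhds ((0, t0), (0 :: complex, t0)). den (fst (fst z)) (snd (fst z)) \<noteq> 0"
    by (rule tendsto_imp_eventually_ne) (use den0 in \<open>simp add: den_0\<close>)
  from eventually_nhds_pair_box[OF this] obtain \<delta>3 where "\<delta>3 > 0"
    and \<delta>3': "\<And>r t r' t'. \<lbrakk>cmod (r - 0) \<le> \<delta>3; cmod (t - t0) \<le> \<delta>3; cmod (r' - 0) \<le> \<delta>3; cmod (t' - t0) \<le> \<delta>3\<rbrakk> \<Longrightarrow> den r t \<noteq> 0"
    unfolding fst_conv snd_conv by metis
  define M where "M = (\<Sum>i<degree p. cmod (\<alpha> i - c))"
  have "M \<ge> 0" unfolding M_def by (rule sum_nonneg) simp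
  have M: "cmod (\<alpha> i - c) \<le> M" if "i < degree p" for i
    unfolding M_def using that by (intro member_le_sum) auto
  \<comment> \<open>The first three radii give the Lipschitz bounds and a nonzero
    \<open>den\<close>. As \<open>sqrt q\<close> lies between 2.6 and 2.8, the bound
    \<open>1 / 10\<close> keeps \<open>t\<close> off 0, 3 and -3 and at distance at least 1 from 1
    and -1. The last bound makes \<open>2 * M * cmod r < 1\<close>.\<close>
  define \<delta> where "\<delta> = Min {\<delta>1, \<delta>2, \<delta>3, 1 / 10, 1 / (2 * M + 1)}"
  have "\<delta> > 0" using \<open>\<delta>1 > 0\<close> \<open>\<delta>2 > 0\<close> \<open>\<delta>3 > 0\<close> \<open>M \<ge> 0\<close> by (simp add: \<delta>_def)
  have \<delta>: "\<delta> \<le> \<delta>1" "\<delta> \<le> \<delta>2" "\<delta> \<le> \<delta>3" "\<delta> \<le> 1 / 10" "\<delta> \<le> 1 / (2 * M + 1)"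
    by (simp_all add: \<delta>_def)
  have small: "2 * M * cmod r < 1" if "cmod r \<le> \<delta>" for r
  proof -
    have "2 * M * cmod r \<le> 2 * M * (1 / (2 * M + 1))"
      using that \<delta>(5) \<open>M \<ge> 0\<close> by (intro mult_left_mono) auto
    also have "\<dots> < 1" using \<open>M \<ge> 0\<close> by simp
    finally show ?thesis .
  qed
  have den: "den r t \<noteq> 0" if "cmod r \<le> \<delta>" "cmod (t - t0) \<le> \<delta>" for r t
    using \<delta>3'[of r t r t] that \<delta>(3) by simp
  have far: "cmod (t - of_real x) \<ge> y" if "cmod (t - t0) \<le> \<delta>" and "\<bar>sqrt q - x\<bar> \<ge> y + 1 / 10" for t x y
  proof -
    have "cmod (t0 - of_real x) = \<bar>sqrt q - x\<bar>" unfolding t0_def by (metis norm_of_real of_real_diff)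
    moreover have "cmod (t0 - of_real x) \<le> cmod (t - t0) + cmod (t - of_real x)"
      using norm_triangle_ineq4[of "t - of_real x" "t - t0"] by simp
    ultimately show ?thesis using that \<delta>(4) by linarith
  qed
  have t_far: "t \<noteq> 0" "t \<noteq> 3" "t \<noteq> - 3" "cmod (t - 1) \<ge> 1" "cmod (t + 1) \<ge> 1" if "cmod (t - t0) \<le> \<delta>" for t
  proof -
    have "\<bar>sqrt q - 0\<bar> \<ge> 1 / 20 + 1 / 10" "\<bar>sqrt q - 3\<bar> \<ge> 1 / 20 + 1 / 10" "\<bar>sqrt q - - 3\<bar> \<ge> 1 / 20 + 1 / 10"
      "\<bar>sqrt q - 1\<bar> \<ge> 1 + 1 / 10" "\<bar>sqrt q - - 1\<bar> \<ge> 1 + 1 / 10"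
      using sq by linarith+
    note far[OF that this(1)] far[OF that this(2)] far[OF that this(3)] far[OF that this(4)] far[OF that this(5)]
    then show "t \<noteq> 0" "t \<noteq> 3" "t \<noteq> - 3" "cmod (t - 1) \<ge> 1" "cmod (t + 1) \<ge> 1"
      by auto
  qed
  interpret saddle next_t next_r t0 \<mu> \<delta> "\<kappa>0 + \<eta>" \<eta>
  proof
    show "\<delta> > 0" by fact
    show "0 \<le> \<kappa>0 + \<eta>" "0 \<le> \<eta>" "\<kappa>0 + \<eta> + \<eta> \<le> 1" "1 + 2 * \<eta> < cmod \<mu>" using \<kappa>0 \<eta> by auto
    show "next_t 0 t0 = t0" by (rule slopes_t(2))
    show "next_r 0 t = 0" for t by (simp add: next_r_def)
  next
    fix r t r' t' assume *: "cmod r \<le> \<delta>" "cmod (t - t0) \<le> \<delta>" "cmod r' \<le> \<delta>" "cmod (t' - t0) \<le> \<delta>"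
    have "cmod (next_r r t - next_r r' t' + of_real \<kappa>0 * (r - r')) \<le> \<eta> * cmod (r - r') + \<eta> * cmod (t - t')"
      using \<delta>1[of r t r' t'] * \<delta>(1) by simp
    moreover have "cmod (next_r r t - next_r r' t') \<le> cmod (next_r r t - next_r r' t' + of_real \<kappa>0 * (r - r')) + \<kappa>0 * cmod (r - r')"
      using norm_triangle_ineq4[of "next_r r t - next_r r' t' + of_real \<kappa>0 * (r - r')" "of_real \<kappa>0 * (r - r')"] \<kappa>0
      by (simp add: norm_mult)
    ultimately show "cmod (next_r r t - next_r r' t') \<le> (\<kappa>0 + \<eta>) * cmod (r - r') + \<eta> * cmod (t - t')"
      by (simp add: algebra_simps)
    show "cmod (next_t r t - next_t r' t' - \<mu> * (t - t')) \<le> \<eta> * cmod (r - r') + \<eta> * cmod (t - t')"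
      using \<delta>2[of r t r' t'] * \<delta>(2) by simp
  next
    fix f g :: "complex \<Rightarrow> complex" assume fg: "f holomorphic_on ball 0 \<delta>" "g holomorphic_on ball 0 \<delta>"
      and box: "\<And>w. w \<in> ball 0 \<delta> \<Longrightarrow> cmod (f w) \<le> \<delta> \<and> cmod (g w - t0) \<le> \<delta>"
    have "(\<lambda>w. den (f w) (g w)) holomorphic_on ball 0 \<delta>"
      unfolding den_def by (intro holomorphic_intros fg)
    moreover have "den (f w) (g w) \<noteq> 0" "g w \<noteq> 0" if "w \<in> ball 0 \<delta>" for w
      using box[OF that] den t_far by auto
    ultimately show "(\<lambda>w. next_r (f w) (g w)) holomorphic_on ball 0 \<delta>"
      and "(\<lambda>w. next_t (f w) (g w)) holomorphic_on ball 0 \<delta>"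
      unfolding next_r_def next_t_def by (intro holomorphic_intros fg; simp)+
  qed
  show ?thesis
  proof (rule that[of \<delta> "\<lambda>w. stable_orbit w 0"])
    show "\<delta> > 0" by fact
    show "(\<lambda>w. stable_orbit w 0) holomorphic_on ball 0 \<delta>" by (rule holomorphic_stable_orbit)
  next
    fix w :: complex assume "w \<in> ball 0 \<delta> - {0}"
    then have w: "w \<noteq> 0" "cmod w \<le> \<delta>" by auto
    define r where "r = stable_coord w (stable_orbit w)"
    define t where "t = stable_orbit w"
    have t_near: "cmod (t n - t0) \<le> \<delta>" for n
      using near_stable_orbit[OF w(2)] by (simp add: t_def)
    have r_le: "cmod (r n) \<le> (\<kappa>0 + \<eta>) ^ n * cmod w" "cmod (r n) \<le> \<delta>" for n
      using norm_stable_coord_le[OF w(2) near_stable_orbit[OF w(2)]] by (simp_all add: r_def)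
    have step_eq: "r (Suc n) = next_r (r n) (t n)" "t (Suc n) = next_t (r n) (t n)" for n
      using stable_orbit_Suc[OF w(2)] by (simp_all add: r_def t_def)
    have r_nz: "r n \<noteq> 0" for n
    proof (induction n)
      case 0
      then show ?case using w by (simp add: r_def)
    next
      case (Suc n)
      \<comment> \<open>From \<open>r n \<noteq> 0\<close>, the next radial coordinate could vanish
        only for \<open>t n\<close> equal to 3 or -3.\<close>
      have "9 - t n * t n = - (t n - 3) * (t n + 3)" by algebra
      with t_far(2,3)[OF t_near] have "9 - t n * t n \<noteq> 0" by (auto simp: add_eq_0_iff2)
      with Suc den[OF r_le(2) t_near] show ?case by (simp add: step_eq next_r_def)
    qed
    \<comment> \<open>The direction is fixed only up to exchanging the first two entries, hence the
      alternating sign.\<close>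
    let ?z = "\<lambda>n. state (1 / r n) ((- 1) ^ n * t n / r n)"
    have step: "weierstrass p (?z n) = Some (?z (Suc n))" for n
    proof -
      have sgn: "(- 1) ^ n = (1 :: complex) \<or> (- 1) ^ n = (- 1 :: complex)" by (cases "even n") auto
      have "weierstrass p (?z n) = Some (state (1 / next_r (r n) (t n)) (- ((- 1) ^ n) * next_t (r n) (t n) / next_r (r n) (t n)))"
        using t_far[OF t_near] r_nz den[OF r_le(2) t_near] M small[OF r_le(2)] sgn
        by (intro weierstrass_projective state_avoids_roots[where M = M]) auto
      then show ?thesis by (simp add: step_eq)
    qed
    have iter: "weierstrass_iter p n (state (1 / w) (stable_orbit w 0 / w)) = Some (?z n)" for n
      by (induction n) (auto simp: weierstrass_iter_def step, simp_all add: r_def t_def)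
    have "(\<lambda>n. (\<kappa>0 + \<eta>) ^ n * cmod w) \<longlonglongrightarrow> 0"
      using \<kappa>0 \<eta> by (intro tendsto_mult_left_zero LIMSEQ_realpow_zero) auto
    then have "(\<lambda>n. cmod (r n)) \<longlonglongrightarrow> 0"
      by (rule tendsto_sandwich[rotated 3, where f = "\<lambda>_. 0"]) (use r_le in auto)
    then have "filterlim (\<lambda>n. inverse (cmod (r n))) at_top sequentially"
      by (rule filterlim_inverse_at_top) (use r_nz in auto)
    then have "filterlim (\<lambda>n. - cmod c + inverse (cmod (r n))) at_top sequentially"
      by (rule filterlim_tendsto_add_at_top[OF tendsto_const])
    \<comment> \<open>The third entry is \<open>c + 1 / r n\<close>, which alone drives the norm to
      infinity.\<close>
    moreover have "\<forall>n. - cmod c + inverse (cmod (r n)) \<le> vnorm (degree p) (?z n)"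
    proof
      fix n
      have "- cmod c + inverse (cmod (r n)) \<le> cmod (?z n 2)"
        using norm_diff_ineq[of "1 / r n" c] by (simp add: state_def norm_inverse divide_inverse add.commute)
      also have "\<dots> \<le> vnorm (degree p) (?z n)"
        using degree by (intro vnorm_ge) simp
      finally show "- cmod c + inverse (cmod (r n)) \<le> vnorm (degree p) (?z n)" .
    qed
    ultimately have "filterlim (\<lambda>n. vnorm (degree p) (?z n)) at_top sequentially"
      by (rule filterlim_at_top_mono[OF _ always_eventually])
    moreover have "state s D \<in> cvecs (degree p)" for s D
      using degree by (simp add: cvecs_def state_def)
    ultimately show "escaping p (state (1 / w) (stable_orbit w 0 / w))"
      unfolding escaping_def iter by simp
  qed
qed

end

section \<open>A punctured disc of escaping points\<close>

theorem theorem2: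
  fixes p :: "complex poly"
  assumes "degree p \<ge> 3" and "rsquarefree p"
  shows "(\<exists>z. escaping p z) \<and>
         (\<exists>U \<gamma>. open U \<and> connected U \<and> U \<noteq> {} \<and>
            (\<forall>k. (\<lambda>w. \<gamma> w k) holomorphic_on U) \<and>
            inj_on \<gamma> U \<and>
            (\<forall>w\<in>U. escaping p (\<gamma> w)))"
proof -
  obtain \<alpha> where \<alpha>: "inj_on \<alpha> {..<degree p}"
    and p: "\<And>x. poly (smult (inverse (lead_coeff p)) p) x = (\<Prod>i<degree p. x - \<alpha> i)"
    by (rule rsquarefree_enumerate_roots[OF assms(2)]) blast
  obtain c a b where cubic: "\<And>x. (x - \<alpha> 0) * (x - \<alpha> 1) * (x - \<alpha> 2) = (x - c) ^ 3 + a * (x - c) + b"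
    by (rule depressed_cubic) blast
  have split: "{..<degree p} = {0, 1, 2} \<union> {3..<degree p}" using assms(1) by auto
  have "(\<Prod>i<degree p. x - \<alpha> i) = ((x - c) ^ 3 + a * (x - c) + b) * (\<Prod>i\<in>{3..<degree p}. x - \<alpha> i)" for x
    unfolding split cubic[symmetric] by (subst prod.union_disjoint) (auto simp: mult_ac)
  then interpret cubic_times_roots p \<alpha> c a b
    using assms(1) \<alpha> p by unfold_locales simp_all
  obtain \<delta> T where "\<delta> > 0" and T: "T holomorphic_on ball 0 \<delta>"
    and esc: "\<And>w. w \<in> ball 0 \<delta> - {0} \<Longrightarrow> escaping p (state (1 / w) (T w / w))"
    by (rule escaping_curve) blast
  define U :: "complex set" where "U = ball 0 \<delta> - {0}"
  define \<gamma> where "\<gamma> w = state (1 / w) (T w / w)" for w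
  \<comment> \<open>A point of \<open>U\<close> also supplies the single escaping vector of the
    first conjunct.\<close>
  have "of_real (\<delta> / 2) \<in> U" using \<open>\<delta> > 0\<close> by (simp add: U_def)
  then have "U \<noteq> {}" by blast
  moreover have "open U" unfolding U_def by (simp add: open_Diff)
  moreover have "connected U" unfolding U_def by (intro connected_punctured_ball) simp
  moreover have "(\<lambda>w. \<gamma> w k) holomorphic_on U" for k
  proof -
    have "T holomorphic_on U" using T by (rule holomorphic_on_subset) (auto simp: U_def)
    then show ?thesis unfolding \<gamma>_def state_def
      by (cases "k = 0"; cases "k = 1"; cases "k = 2"; simp) (auto intro!: holomorphic_intros simp: U_def)
  qed
  moreover have "inj_on \<gamma> U"
  proof (rule inj_onI)
    fix w w' assume "w \<in> U" "w' \<in> U" "\<gamma> w = \<gamma> w'"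
    \<comment> \<open>The third entry is \<open>c + 1 / w\<close>, which determines
      \<open>w\<close>.\<close>
    then have "\<gamma> w 2 = \<gamma> w' 2" by simp
    with \<open>w \<in> U\<close> \<open>w' \<in> U\<close> show "w = w'" by (simp add: \<gamma>_def state_def U_def)
  qed
  moreover have "\<forall>w\<in>U. escaping p (\<gamma> w)" using esc by (simp add: U_def \<gamma>_def)
  ultimately show ?thesis by blast
qed

end
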